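(* Let $\mathcal{A}$ be a finite set of chords of a fixed circle such that the circle graph $G(\mathcal{A})$ does not contain $K_4$ as a subgraph. Then $G(\mathcal{A})$ admits a proper coloring with at most $30$ colors; that is, $\chi(G(\mathcal{A}))\le 30$.
   Context: Fix a circle. For a finite set $\mathcal{A}$ of chords of this circle, the circle graph $G(\mathcal{A})$ has vertex set $\mathcal{A}$, and two chords are adjacent if and only if they have a common inner point (i.e. they cross). A proper coloring of a graph assigns colors to vertices so that adjacent vertices receive different colors; a coloring of a set of chords means a proper coloring of the corresponding circle graph. *)

theory Defs
  imports "HOL-Analysis.Analysis" "Graph_Theory.Graph_Theory"
begin

definition chord :: "complex \<Rightarrow> real \<Rightarrow> complex set \<Rightarrow> bool" where
  "chord c r X \<longleftrightarrow> (\<exists>a\<in>sphere c r. \<exists>b\<in>sphere c r. a \<noteq> b \<and> X = closed_segment a b)"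

(* The inner points of a chord are those other than its two endpoints, so chords
   that merely share an endpoint do not cross. *)
definition cross :: "complex set \<Rightarrow> complex set \<Rightarrow> bool" where
  "cross X Y \<longleftrightarrow> rel_interior X \<inter> rel_interior Y \<noteq> {}"

(* An undirected simple graph is a loop-free symmetric digraph, as in the locale graph. *)
definition circle_graph :: "complex set set \<Rightarrow> complex set pair_pre_digraph" where
  "circle_graph A =
    \<lparr> pverts = A, parcs = {(X, Y). X \<in> A \<and> Y \<in> A \<and> X \<noteq> Y \<and> cross X Y} \<rparr>"

definition proper_coloring :: "('a, 'b) pre_digraph \<Rightarrow> ('a \<Rightarrow> nat) \<Rightarrow> bool" where
  "proper_coloring G f \<longleftrightarrow> (\<forall>(u, v)\<in>arcs_ends G. f u \<noteq> f v)"

definition colorable :: "('a, 'b) pre_digraph \<Rightarrow> nat \<Rightarrow> bool" where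
  "colorable G k \<longleftrightarrow> (\<exists>f. proper_coloring G f \<and> f ` verts G \<subseteq> {..<k})"

(* Meaningful for finite loop-free graphs, which are colorable with some number of colors. *)
definition chromatic_number :: "('a, 'b) pre_digraph \<Rightarrow> nat" where
  "chromatic_number G = (LEAST k. colorable G k)"

lemma rel_interior_chord:
  assumes "chord c r X"
  shows "rel_interior X = X \<inter> ball c r"
proof -
  obtain a b where ab: "a \<in> sphere c r" "b \<in> sphere c r" "a \<noteq> b" "X = closed_segment a b"
    using assms by (auto simp: chord_def)
  have "x \<in> ball c r" if "x \<in> open_segment a b" for x
    using dist_decreases_open_segment[OF that, of c] ab(1,2) by auto
  then show ?thesis
    using ab by (auto simp: rel_interior_closed_segment open_segment_def)
qed

lemma pair_graph_circle_graph:
  assumes "finite A"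
  shows "pair_graph (circle_graph A)"
proof
  show "finite (parcs (circle_graph A))"
    by (rule finite_subset[of _ "A \<times> A"]) (use assms in \<open>auto simp: circle_graph_def\<close>)
qed (use assms in \<open>auto simp: circle_graph_def cross_def sym_def symmetric_def\<close>)

end

theory Submission
  imports Defs
begin

text \<open>Cut the circle open, so that chords become intervals and crossing becomes overlapping.
  Intervals through a common point (a pillar) form a permutation graph, which has a proper
  3-coloring if there is no \<open>K\<^sub>4\<close>. Pillars are placed recursively, each carrying one of 10 blocks
  of 3 colors, and every interval takes its color from the oldest pillar that it contains.

  The intervals inside a segment only conflict with those that have exactly one endpoint in the
  segment. Invariant: these dangling intervals use at most 8 blocks. If they use at most 7, one
  further pillar with a fresh block preserves the invariant. If they use 8, cut the segment
  greedily into pieces seeing at most 6 of the blocks each. If more than four pieces were needed,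
  there would be four consecutive places each seeing at least 7 of the 8 blocks. The blocks are
  linearly ordered by the outer endpoints of their intervals, and each place misses at most one
  block, so one can pick from the four places intervals of strictly increasing blocks; they form a
  \<open>K\<^sub>4\<close>. Hence three pillars suffice, the middle one with a fresh block and the two outer ones
  sharing a second fresh block, and each piece sees at most 6 + 2 blocks.\<close>

section \<open>Intervals with distinct endpoints and segments of the line\<close>

text \<open>No two endpoints coincide, so overlapping is decided by strict inequalities. Natural
  numbers as positions provide a least position at which a greedy cut becomes overfull.\<close>

locale interval_system =
  fixes V :: "'a set" and l r :: "'a \<Rightarrow> nat"
  assumes finite_V: "finite V"
    and l_less_r: "I \<in> V \<Longrightarrow> l I < r I"
    and inj_l: "inj_on l V"
    and inj_r: "inj_on r V"
    and l_neq_r: "I \<in> V \<Longrightarrow> J \<in> V \<Longrightarrow> l I \<noteq> r J"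
begin

definition overlap :: "'a \<Rightarrow> 'a \<Rightarrow> bool" where
  "overlap I J \<longleftrightarrow> l I < l J \<and> l J < r I \<and> r I < r J \<or> l J < l I \<and> l I < r J \<and> r J < r I"

definition four_clique :: bool where
  "four_clique \<longleftrightarrow> (\<exists>I\<in>V. \<exists>J\<in>V. \<exists>K\<in>V. \<exists>L\<in>V.
     overlap I J \<and> overlap I K \<and> overlap I L \<and> overlap J K \<and> overlap J L \<and> overlap K L)"

text \<open>Segments are half-open, \<open>{s..<e}\<close>: a pillar at \<open>q\<close> stands just before position \<open>q\<close>, so it lies
  in \<open>I\<close> iff \<open>l I < q \<le> r I\<close>, and it never coincides with an endpoint.\<close>

definition inside :: "nat \<Rightarrow> nat \<Rightarrow> 'a set" where
  "inside s e = {I \<in> V. s \<le> l I \<and> r I < e}"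

definition dangling :: "nat \<Rightarrow> nat \<Rightarrow> 'a set" where
  "dangling s e = {I \<in> V. l I < s \<and> s \<le> r I \<and> r I < e \<or> s \<le> l I \<and> l I < e \<and> e \<le> r I}"

text \<open>Meant for dangling intervals: one that starts before \<open>s\<close> has its right
  endpoint in the segment, hence \<open>e\<close> need not be mentioned.\<close>

definition inner :: "nat \<Rightarrow> 'a \<Rightarrow> nat" where
  "inner s I = (if s \<le> l I then l I else r I)"

text \<open>The order of the outer endpoints when the outside of the segment is traversed
  circularly, starting from its right end.\<close>

definition outer_before :: "nat \<Rightarrow> 'a \<Rightarrow> 'a \<Rightarrow> bool" where
  "outer_before s I J \<longleftrightarrow>
     (if s \<le> l I then s \<le> l J \<longrightarrow> r I < r J else l J < s \<and> l I < l J)"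

text \<open>What a piece \<open>{u..<v}\<close> of the segment inherits from outside
  \<open>{s..<e}\<close>. Intervals inside the segment that leave the piece are not counted; they
  will carry the blocks of new pillars.\<close>

definition seen :: "('a \<Rightarrow> nat) \<Rightarrow> nat \<Rightarrow> nat \<Rightarrow> nat \<Rightarrow> nat \<Rightarrow> nat set" where
  "seen \<beta> s e u v = \<beta> ` {I \<in> dangling s e. u \<le> inner s I \<and> inner s I < v}"

text \<open>Each block occupies its own stretch of the outside, and \<open>zs\<close> lists the
  stretches in circular order. Blocks without a dangling interval may occur in \<open>zs\<close>, so
  the list can be kept when a segment is cut.\<close>

definition coherent :: "('a \<Rightarrow> nat) \<Rightarrow> nat \<Rightarrow> nat \<Rightarrow> nat list \<Rightarrow> bool" where
  "coherent \<beta> s e zs \<longleftrightarrow> distinct zs \<and> set zs \<subseteq> {..<10} \<and> \<beta> ` dangling s e \<subseteq> set zs \<and>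
     sorted_wrt (\<lambda>x y. \<forall>I\<in>dangling s e. \<forall>J\<in>dangling s e.
       \<beta> I = x \<longrightarrow> \<beta> J = y \<longrightarrow> outer_before s I J) zs"

text \<open>A color is a pair of a block and a color within the block; of the dangling intervals only the
  blocks \<open>\<beta>\<close> matter.\<close>

definition extendable :: "('a \<Rightarrow> nat) \<Rightarrow> nat \<Rightarrow> nat \<Rightarrow> bool" where
  "extendable \<beta> s e \<longleftrightarrow> (\<exists>f :: 'a \<Rightarrow> nat \<times> nat.
     (\<forall>I\<in>inside s e. f I \<in> {..<10} \<times> {..<3}) \<and>
     (\<forall>I\<in>inside s e. \<forall>J\<in>inside s e. overlap I J \<longrightarrow> f I \<noteq> f J) \<and>
     (\<forall>I\<in>inside s e. \<forall>J\<in>dangling s e. overlap I J \<longrightarrow> fst (f I) \<noteq> \<beta> J))"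

text \<open>Intervals that are not inside the segment keep their block even if they contain
  \<open>q\<close>: the older pillar wins.\<close>

definition set_pillar :: "('a \<Rightarrow> nat) \<Rightarrow> nat \<Rightarrow> nat \<Rightarrow> nat \<Rightarrow> nat \<Rightarrow> 'a \<Rightarrow> nat" where
  "set_pillar \<beta> s e q c I = (if I \<in> inside s e \<and> l I < q \<and> q \<le> r I then c else \<beta> I)"

lemma overlap_sym: "overlap I J \<longleftrightarrow> overlap J I"
  by (auto simp: overlap_def)

lemma finite_dangling: "finite (dangling s e)"
  using finite_V by (simp add: dangling_def)

lemma finite_seen: "finite (seen \<beta> s e u v)"
  using finite_dangling by (simp add: seen_def)

text \<open>Around the circle the order is inner endpoint of \<open>I\<close>, inner endpoint of
  \<open>J\<close>, outer endpoint of \<open>I\<close>, outer endpoint of \<open>J\<close>, so the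
  endpoints alternate. Distinctness of endpoints makes the weak inequality strict.\<close>

lemma overlap_if_outer_before:
  assumes "I \<in> dangling s e" "J \<in> dangling s e" "outer_before s I J" "inner s I \<le> inner s J" "I \<noteq> J"
  shows "overlap I J"
proof -
  have V: "I \<in> V" "J \<in> V" using assms by (auto simp: dangling_def)
  have "l I \<noteq> l J" "r I \<noteq> r J" "l I \<noteq> r J" "l J \<noteq> r I"
    using V assms(5) inj_l inj_r l_neq_r by (auto simp: inj_on_def)
  then show ?thesis
    using assms V l_less_r[of I] l_less_r[of J]
    by (auto simp: dangling_def outer_before_def inner_def overlap_def split: if_splits)
qed

section \<open>Coloring and invariant when a pillar is set\<close>

text \<open>Two intervals containing the pillar overlap iff their left and right endpoints come in
  the same order. This is a strict partial order, and a chain of four would be a clique.\<close>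

lemma three_coloring_at_pillar:
  assumes "\<not> four_clique"
  obtains h :: "'a \<Rightarrow> nat" where "\<And>I. h I < 3"
    "\<And>I J. \<lbrakk>I \<in> V; J \<in> V; l I < q; q \<le> r I; l J < q; q \<le> r J; overlap I J\<rbrakk> \<Longrightarrow> h I \<noteq> h J"
proof -
  define T where "T = {I \<in> V. l I < q \<and> q \<le> r I}"
  define P where "P I J \<longleftrightarrow> I \<in> T \<and> J \<in> T \<and> l I < l J \<and> r I < r J" for I J
  \<comment> \<open>The height in the order \<open>P\<close>, capped at 2; by \<open>no\<close>
    below, the cap never identifies comparable intervals.\<close>
  define h :: "'a \<Rightarrow> nat" where "h I = (if \<exists>J K. P J K \<and> P K I then 2 else if \<exists>K. P K I then 1 else 0)" for I
  have ov: "overlap I J" if "P I J" for I J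
    using that by (auto simp: P_def T_def overlap_def)
  have tr: "P I K" if "P I J" "P J K" for I J K
    using that by (auto simp: P_def)
  have no: False if "P I J" "P J K" "P K L" for I J K L
  proof -
    have "I \<in> V" "J \<in> V" "K \<in> V" "L \<in> V" using that by (auto simp: P_def T_def)
    then show False using assms that tr ov unfolding four_clique_def by meson
  qed
  have "h I \<noteq> h J" if "P I J" for I J
    using that no unfolding h_def by (auto split: if_splits) 
  moreover have "P I J \<or> P J I"
    if "I \<in> V" "J \<in> V" "l I < q" "q \<le> r I" "l J < q" "q \<le> r J" "overlap I J" for I J
    using that by (auto simp: P_def T_def overlap_def)
  ultimately have "h I \<noteq> h J"
    if "I \<in> V" "J \<in> V" "l I < q" "q \<le> r I" "l J < q" "q \<le> r J" "overlap I J" for I J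
    using that by metis
  moreover have "h I < 3" for I by (simp add: h_def)
  ultimately show ?thesis using that by blast
qed

text \<open>Seen from \<open>{s..<q}\<close>, the outer endpoints of the newly colored intervals lie
  in \<open>{q..<e}\<close>, before those of all older ones, so \<open>c\<close> comes first. Seen
  from \<open>{q..<e}\<close> they lie in \<open>{s..<q}\<close>, at the end of the traversal, so
  \<open>c\<close> comes last.\<close>

lemma coherent_set_pillar:
  assumes "coherent \<beta> s e zs" "s \<le> q" "q \<le> e" "c < 10" "c \<notin> set zs"
  shows "coherent (set_pillar \<beta> s e q c) s q (c # zs)"
    and "coherent (set_pillar \<beta> s e q c) q e (zs @ [c])"
proof -
  let ?b = "set_pillar \<beta> s e q c"
  have ne: "\<beta> I \<noteq> c" if "I \<in> dangling s e" for I
    using that assms(1,5) by (auto simp: coherent_def)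
  have L: "I \<in> dangling s e \<and> ?b I = \<beta> I \<or> I \<in> inside s e \<and> ?b I = c" if "I \<in> dangling s q" for I
    using that assms(2,3) by (auto simp: dangling_def inside_def set_pillar_def)
  have R: "I \<in> dangling s e \<and> ?b I = \<beta> I \<or> I \<in> inside s e \<and> ?b I = c" if "I \<in> dangling q e" for I
    using that assms(2,3) by (auto simp: dangling_def inside_def set_pillar_def)
  have L1: "outer_before s I J" if "I \<in> dangling s q" "J \<in> dangling s q" "?b I = c" "?b J \<noteq> c" for I J
    using L[OF that(1)] L[OF that(2)] that ne assms(2,3)
    by (auto simp: outer_before_def dangling_def inside_def)
  have R1: "outer_before q J I" if "I \<in> dangling q e" "J \<in> dangling q e" "?b I = c" "?b J \<noteq> c" for I J
    using R[OF that(1)] R[OF that(2)] that ne assms(2,3)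
    by (auto simp: outer_before_def dangling_def inside_def)
  \<comment> \<open>An old interval that still dangles from \<open>{q..<e}\<close> leaves it on the
    same side as it leaves \<open>{s..<e}\<close>, so moving the start from \<open>s\<close> to
    \<open>q\<close> keeps the order.\<close>
  have R2: "outer_before q I J" if "outer_before s I J" "I \<in> dangling q e" "J \<in> dangling q e"
    "I \<in> dangling s e" "J \<in> dangling s e" for I J
    using that assms(2,3)
    by (auto simp: outer_before_def dangling_def split: if_splits)
  have srt: "sorted_wrt (\<lambda>x y. \<forall>I\<in>dangling s e. \<forall>J\<in>dangling s e.
       \<beta> I = x \<longrightarrow> \<beta> J = y \<longrightarrow> outer_before s I J) zs"
    using assms(1) by (simp add: coherent_def)
  have "sorted_wrt (\<lambda>x y. \<forall>I\<in>dangling s q. \<forall>J\<in>dangling s q.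
       ?b I = x \<longrightarrow> ?b J = y \<longrightarrow> outer_before s I J) zs"
    by (rule sorted_wrt_mono_rel[OF _ srt]) (metis L assms(5))
  moreover have "\<forall>y\<in>set zs. \<forall>I\<in>dangling s q. \<forall>J\<in>dangling s q.
       ?b I = c \<longrightarrow> ?b J = y \<longrightarrow> outer_before s I J"
    by (intro ballI impI L1) (use assms(5) in auto)
  moreover have "?b ` dangling s q \<subseteq> set (c # zs)"
    using L assms(1) by (fastforce simp: coherent_def image_subset_iff)
  ultimately show "coherent ?b s q (c # zs)"
    using assms(1,4,5) unfolding coherent_def by simp
  have "sorted_wrt (\<lambda>x y. \<forall>I\<in>dangling q e. \<forall>J\<in>dangling q e.
       ?b I = x \<longrightarrow> ?b J = y \<longrightarrow> outer_before q I J) zs"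
    by (rule sorted_wrt_mono_rel[OF _ srt]) (metis R R2 assms(5))
  moreover have "\<forall>y\<in>set zs. \<forall>I\<in>dangling q e. \<forall>J\<in>dangling q e.
       ?b I = y \<longrightarrow> ?b J = c \<longrightarrow> outer_before q I J"
    by (intro ballI impI R1) (use assms(5) in auto)
  moreover have "?b ` dangling q e \<subseteq> set (zs @ [c])"
    using R assms(1) by (fastforce simp: coherent_def image_subset_iff)
  ultimately show "coherent ?b q e (zs @ [c])"
    using assms(1,4,5) unfolding coherent_def by (simp add: sorted_wrt_append)
qed

text \<open>An interval inside the segment lies left of \<open>q\<close>, lies right of
  \<open>q\<close>, or contains \<open>q\<close>. Left and right never overlap; those containing
  \<open>q\<close> get block \<open>c\<close> with a 3-coloring, and they dangle from both pieces
  with block \<open>c\<close>, which the colorings of the pieces therefore avoid.\<close>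

lemma extendable_set_pillar:
  assumes "\<not> four_clique" "s \<le> q" "q \<le> e" "c < 10" "c \<notin> \<beta> ` dangling s e"
    and "extendable (set_pillar \<beta> s e q c) s q" "extendable (set_pillar \<beta> s e q c) q e"
  shows "extendable \<beta> s e"
proof -
  let ?b = "set_pillar \<beta> s e q c"
  obtain h :: "'a \<Rightarrow> nat" where h: "\<And>I. h I < 3"
    "\<And>I J. \<lbrakk>I \<in> V; J \<in> V; l I < q; q \<le> r I; l J < q; q \<le> r J; overlap I J\<rbrakk> \<Longrightarrow> h I \<noteq> h J"
    using three_coloring_at_pillar[OF assms(1)] by blast
  obtain f :: "'a \<Rightarrow> nat \<times> nat" where f: "\<forall>I\<in>inside s q. f I \<in> {..<10} \<times> {..<3}"
     "\<forall>I\<in>inside s q. \<forall>J\<in>inside s q. overlap I J \<longrightarrow> f I \<noteq> f J"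
     "\<forall>I\<in>inside s q. \<forall>J\<in>dangling s q. overlap I J \<longrightarrow> fst (f I) \<noteq> ?b J"
    using assms(6) unfolding extendable_def by blast
  obtain g :: "'a \<Rightarrow> nat \<times> nat" where g: "\<forall>I\<in>inside q e. g I \<in> {..<10} \<times> {..<3}"
     "\<forall>I\<in>inside q e. \<forall>J\<in>inside q e. overlap I J \<longrightarrow> g I \<noteq> g J"
     "\<forall>I\<in>inside q e. \<forall>J\<in>dangling q e. overlap I J \<longrightarrow> fst (g I) \<noteq> ?b J"
    using assms(7) unfolding extendable_def by blast
  define k where "k I = (if r I < q then f I else if q \<le> l I then g I else (c, h I))" for I
  have parts: "I \<in> inside s q \<and> k I = f I \<or> I \<in> inside q e \<and> k I = g I \<or>
      l I < q \<and> q \<le> r I \<and> k I = (c, h I) \<and> ?b I = c" if "I \<in> inside s e" for I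
    using that assms(2,3) l_less_r[of I] by (auto simp: inside_def k_def set_pillar_def)
  have "k I \<in> {..<10} \<times> {..<3}" if "I \<in> inside s e" for I
    using parts[OF that] f(1) g(1) h(1) assms(4) by auto
  moreover have "fst (k I) \<noteq> \<beta> J" if I: "I \<in> inside s e" and J: "J \<in> dangling s e" and "overlap I J" for I J
  proof -
    have b: "?b J = \<beta> J"
      using J by (auto simp: dangling_def inside_def set_pillar_def)
    \<comment> \<open>\<open>J\<close> has a single endpoint in \<open>{s..<e}\<close>; since
      \<open>J\<close> overlaps \<open>I\<close>, this endpoint lies within \<open>I\<close> and
      hence in the piece of \<open>I\<close>.\<close>
    have "J \<in> dangling s q" if "I \<in> inside s q"
      using that J \<open>overlap I J\<close> assms(2,3) by (auto simp: dangling_def inside_def overlap_def)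
    moreover have "J \<in> dangling q e" if "I \<in> inside q e"
      using that J \<open>overlap I J\<close> assms(2,3) by (auto simp: dangling_def inside_def overlap_def)
    ultimately show ?thesis
      using parts[OF I] f(3) g(3) b \<open>overlap I J\<close> J assms(5) by fastforce
  qed
  moreover have "k I \<noteq> k J" if I: "I \<in> inside s e" and J: "J \<in> inside s e" and ov: "overlap I J" for I J
  proof -
    have V: "I \<in> V" "J \<in> V" using I J by (auto simp: inside_def)
    have dl: "Y \<in> dangling s q" if "X \<in> inside s q" "l Y < q" "q \<le> r Y" "overlap X Y" "Y \<in> inside s e" for X Y
      using that by (auto simp: dangling_def inside_def)
    have dr: "Y \<in> dangling q e" if "X \<in> inside q e" "l Y < q" "q \<le> r Y" "overlap X Y" "Y \<in> inside s e" for X Y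
      using that by (auto simp: dangling_def inside_def)
    have nlr: False if "X \<in> inside s q" "Y \<in> inside q e" "overlap X Y" for X Y
      using that by (auto simp: overlap_def inside_def)
    have ov': "overlap J I" using ov overlap_sym by blast
    consider "I \<in> inside s q" "k I = f I" | "I \<in> inside q e" "k I = g I" |
      "l I < q" "q \<le> r I" "k I = (c, h I)" "?b I = c"
      using parts[OF I] by blast
    then show ?thesis
    proof cases
      case 1
      from parts[OF J] show ?thesis
      proof (elim disjE conjE)
        assume "J \<in> inside s q" "k J = f J"
        then show ?thesis using f(2) 1 ov by simp
      next
        assume "J \<in> inside q e"
        then show ?thesis using nlr 1 ov by blast
      next
        assume "l J < q" "q \<le> r J" and *: "k J = (c, h J)" "?b J = c"
        then have "J \<in> dangling s q" using dl 1 ov J by blast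
        then have "fst (f I) \<noteq> c" using f(3) 1 ov * by metis
        then show ?thesis using 1 * by auto
      qed
    next
      case 2
      from parts[OF J] show ?thesis
      proof (elim disjE conjE)
        assume "J \<in> inside s q"
        then show ?thesis using nlr 2 ov' by blast
      next
        assume "J \<in> inside q e" "k J = g J"
        then show ?thesis using g(2) 2 ov by simp
      next
        assume "l J < q" "q \<le> r J" and *: "k J = (c, h J)" "?b J = c"
        then have "J \<in> dangling q e" using dr 2 ov J by blast
        then have "fst (g I) \<noteq> c" using g(3) 2 ov * by metis
        then show ?thesis using 2 * by auto
      qed
    next
      case 3
      from parts[OF J] show ?thesis
      proof (elim disjE conjE)
        assume *: "J \<in> inside s q" "k J = f J"
        then have "I \<in> dangling s q" using dl 3 ov' I by blast
        then have "fst (f J) \<noteq> c" using f(3) 3 ov' * by metis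
        then show ?thesis using 3 * by (metis fst_conv)
      next
        assume *: "J \<in> inside q e" "k J = g J"
        then have "I \<in> dangling q e" using dr 3 ov' I by blast
        then have "fst (g J) \<noteq> c" using g(3) 3 ov' * by metis
        then show ?thesis using 3 * by (metis fst_conv)
      next
        assume "l J < q" "q \<le> r J" "k J = (c, h J)"
        then show ?thesis using h(2)[OF V] 3 ov by simp
      qed
    qed
  qed
  ultimately show ?thesis unfolding extendable_def by blast
qed

section \<open>Cutting a segment into four sparse pieces\<close>

text \<open>Cut as late as possible: \<open>w\<close> is \<open>e\<close>, or one less than the
  first end position at which seven blocks are seen.\<close>

lemma greedy_cut:
  assumes "u \<le> e"
  obtains w where "u \<le> w" "w \<le> e" "card (seen \<beta> s e u w) \<le> 6"
    "w < e \<Longrightarrow> 7 \<le> card (seen \<beta> s e u (Suc w))"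
proof (cases "card (seen \<beta> s e u e) \<le> 6")
  case True
  then show ?thesis using that[of e] assms by simp
next
  case False
  define v where "v = (LEAST v. 7 \<le> card (seen \<beta> s e u v))"
  have v: "7 \<le> card (seen \<beta> s e u v)" "v \<le> e"
    using False LeastI[of "\<lambda>v. 7 \<le> card (seen \<beta> s e u v)" e] 
      Least_le[of "\<lambda>v. 7 \<le> card (seen \<beta> s e u v)" e] unfolding v_def by simp_all
  \<comment> \<open>An empty range sees nothing, so \<open>v\<close> has a predecessor that is still
    at least \<open>u\<close>.\<close>
  have "u < v"
  proof (rule ccontr)
    assume "\<not> u < v"
    then have "seen \<beta> s e u v = {}" by (auto simp: seen_def)
    then show False using v by simp
  qed
  then obtain w where w: "v = Suc w" using less_imp_Suc_add by blast
  have "\<not> 7 \<le> card (seen \<beta> s e u w)"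
    using not_less_Least[of w "\<lambda>v. 7 \<le> card (seen \<beta> s e u v)"] w unfolding v_def by simp
  then show ?thesis using that[of w] v w \<open>u < v\<close> by simp
qed

lemma nth_or_Suc_nth_mem:
  assumes "distinct zs" "T \<subseteq> set zs" "length zs \<le> Suc (card T)" "Suc i < length zs"
  shows "zs ! i \<in> T \<or> zs ! Suc i \<in> T"
proof (rule ccontr)
  assume "\<not> ?thesis"
  then have "{zs ! i, zs ! Suc i} \<subseteq> set zs - T" using assms by auto
  moreover have "card {zs ! i, zs ! Suc i} = 2"
    using assms by (simp add: nth_eq_iff_index_eq)
  ultimately have "2 \<le> card (set zs - T)"
    by (metis List.finite_set card_mono finite_Diff)
  then show False
    using assms by (simp add: card_Diff_subset finite_subset distinct_card)
qed

text \<open>Of any two consecutive entries of \<open>zs\<close>, each place sees at least one. The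
  four choices thus use indices at most 1, 3, 5 and 7, which is why eight blocks suffice.\<close>

lemma four_clique_if_overfull:
  assumes coh: "coherent \<beta> s e zs" and len: "length zs = 8"
    and full: "7 \<le> card (seen \<beta> s e s (Suc q1))" "7 \<le> card (seen \<beta> s e q1 (Suc q2))"
      "7 \<le> card (seen \<beta> s e q2 (Suc q3))" "7 \<le> card (seen \<beta> s e q3 e)"
  shows four_clique
proof -
  have srt: "sorted_wrt (\<lambda>x y. \<forall>I\<in>dangling s e. \<forall>J\<in>dangling s e.
       \<beta> I = x \<longrightarrow> \<beta> J = y \<longrightarrow> outer_before s I J) zs"
    using coh by (simp add: coherent_def)
  have pick: "\<exists>j I. i \<le> j \<and> j \<le> Suc i \<and> I \<in> dangling s e \<and> \<beta> I = zs ! j \<and>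
      u \<le> inner s I \<and> inner s I < v"
    if "7 \<le> card (seen \<beta> s e u v)" "i \<le> 6" for i u v
  proof -
    have "seen \<beta> s e u v \<subseteq> set zs" using coh by (auto simp: coherent_def seen_def)
    then have "zs ! i \<in> seen \<beta> s e u v \<or> zs ! Suc i \<in> seen \<beta> s e u v"
      using nth_or_Suc_nth_mem[of zs "seen \<beta> s e u v" i] that len coh by (auto simp: coherent_def)
    then obtain j where "j = i \<or> j = Suc i" "zs ! j \<in> seen \<beta> s e u v" by blast
    then show ?thesis unfolding seen_def by (intro exI[of _ j]) auto
  qed
  obtain i1 I1 where 1: "i1 \<le> Suc 0" "I1 \<in> dangling s e" "\<beta> I1 = zs ! i1" "inner s I1 < Suc q1"
    using pick[OF full(1), of 0] by blast
  obtain i2 I2 where 2: "Suc i1 \<le> i2" "i2 \<le> Suc (Suc i1)" "I2 \<in> dangling s e" "\<beta> I2 = zs ! i2"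
    "q1 \<le> inner s I2" "inner s I2 < Suc q2"
    using pick[OF full(2), of "Suc i1"] 1(1) by auto
  obtain i3 I3 where 3: "Suc i2 \<le> i3" "i3 \<le> Suc (Suc i2)" "I3 \<in> dangling s e" "\<beta> I3 = zs ! i3"
    "q2 \<le> inner s I3" "inner s I3 < Suc q3"
    using pick[OF full(3), of "Suc i2"] 1(1) 2(2) by auto
  obtain i4 I4 where 4: "Suc i3 \<le> i4" "i4 \<le> Suc (Suc i3)" "I4 \<in> dangling s e" "\<beta> I4 = zs ! i4"
    "q3 \<le> inner s I4"
    using pick[OF full(4), of "Suc i3"] 1(1) 2(2) 3(2) by auto
  \<comment> \<open>Neighboring places share the position of the cut between them, so inner
    endpoints are only known to be weakly ordered; \<open>I\<close> and \<open>J\<close> differ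
    because their blocks do.\<close>
  have ov: "overlap I J" if "I \<in> dangling s e" "J \<in> dangling s e" "\<beta> I = zs ! i" "\<beta> J = zs ! j"
    "i < j" "j < 8" "inner s I \<le> inner s J" for I J i j
  proof (rule overlap_if_outer_before)
    show "outer_before s I J"
      using sorted_wrt_nth_less[OF srt, of i j] that len by simp
    have "zs ! i \<noteq> zs ! j" using coh that len by (simp add: coherent_def nth_eq_iff_index_eq)
    then show "I \<noteq> J" using that by auto
  qed (use that in auto)
  have "I1 \<in> V" "I2 \<in> V" "I3 \<in> V" "I4 \<in> V" using 1 2 3 4 by (auto simp: dangling_def)
  moreover have "overlap I1 I2" using 1 2 3 4 by (intro ov[of I1 I2 i1 i2]) auto
  moreover have "overlap I1 I3" using 1 2 3 4 by (intro ov[of I1 I3 i1 i3]) auto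
  moreover have "overlap I1 I4" using 1 2 3 4 by (intro ov[of I1 I4 i1 i4]) auto
  moreover have "overlap I2 I3" using 1 2 3 4 by (intro ov[of I2 I3 i2 i3]) auto
  moreover have "overlap I2 I4" using 1 2 3 4 by (intro ov[of I2 I4 i2 i4]) auto
  moreover have "overlap I3 I4" using 1 2 3 4 by (intro ov[of I3 I4 i3 i4]) auto
  ultimately show ?thesis unfolding four_clique_def by blast
qed

lemma four_sparse_pieces:
  assumes "\<not> four_clique" "coherent \<beta> s e zs" "length zs = 8" "s \<le> e"
  obtains q1 q2 q3 where "s \<le> q1" "q1 \<le> q2" "q2 \<le> q3" "q3 \<le> e"
    "card (seen \<beta> s e s q1) \<le> 6" "card (seen \<beta> s e q1 q2) \<le> 6"
    "card (seen \<beta> s e q2 q3) \<le> 6" "card (seen \<beta> s e q3 e) \<le> 6"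
proof -
  obtain q1 where q1: "s \<le> q1" "q1 \<le> e" "card (seen \<beta> s e s q1) \<le> 6"
    "q1 < e \<Longrightarrow> 7 \<le> card (seen \<beta> s e s (Suc q1))"
    using greedy_cut[OF assms(4)] by blast
  obtain q2 where q2: "q1 \<le> q2" "q2 \<le> e" "card (seen \<beta> s e q1 q2) \<le> 6"
    "q2 < e \<Longrightarrow> 7 \<le> card (seen \<beta> s e q1 (Suc q2))"
    using greedy_cut[OF q1(2)] by blast
  obtain q3 where q3: "q2 \<le> q3" "q3 \<le> e" "card (seen \<beta> s e q2 q3) \<le> 6"
    "q3 < e \<Longrightarrow> 7 \<le> card (seen \<beta> s e q2 (Suc q3))"
    using greedy_cut[OF q2(2)] by blast
  have "card (seen \<beta> s e q3 e) \<le> 6"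
  proof (rule ccontr)
    assume *: "\<not> ?thesis"
    \<comment> \<open>Then \<open>q1\<close> and \<open>q2\<close> are below \<open>e\<close> too,
      so each of the three greedy cuts was forced by a seventh block.\<close>
    have "q3 < e"
    proof (rule ccontr)
      assume "\<not> q3 < e"
      then have "seen \<beta> s e q3 e = {}" by (auto simp: seen_def)
      then show False using * by simp
    qed
    then have "four_clique"
      using q1 q2 q3 * by (intro four_clique_if_overfull[OF assms(2,3), of q1 q2 q3]) auto
    then show False using assms(1) by simp
  qed
  then show ?thesis using that q1 q2 q3 by blast
qed

section \<open>The recursive coloring\<close>

text \<open>Induction on the number of endpoints in the segment.\<close>

lemma extendable_if_coherent:
  assumes "\<not> four_clique" "coherent \<beta> s e zs" "card (\<beta> ` dangling s e) \<le> 8" "s \<le> e"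
  shows "extendable \<beta> s e"
  using assms(2-)
proof (induction "card ((l ` V \<union> r ` V) \<inter> {s..<e})" arbitrary: \<beta> s e zs rule: less_induct)
  case less
  let ?E = "l ` V \<union> r ` V"
  let ?D = "\<beta> ` dangling s e"
  have finE: "finite (?E \<inter> {s..<e})" by simp
  \<comment> \<open>Dropping blocks without a dangling interval leaves at most 8 of the 10, so two
    fresh blocks \<open>c\<close> and \<open>d\<close> exist.\<close>
  define ws where "ws = filter (\<lambda>x. x \<in> ?D) zs"
  have coh: "coherent \<beta> s e ws"
    using less.prems(1) by (auto simp: coherent_def ws_def sorted_wrt_filter)
  have set_ws: "set ws = ?D" using less.prems(1) by (auto simp: coherent_def ws_def)
  have len: "length ws = card ?D"
    using coh set_ws by (metis coherent_def distinct_card)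
  obtain c where c: "c < 10" "c \<notin> set ws"
  proof -
    have "card (set ws) < card {..<10::nat}" using less.prems(2) set_ws by simp
    then have "\<not> {..<10} \<subseteq> set ws" by (metis List.finite_set card_mono not_le)
    then show ?thesis using that by blast
  qed
  obtain d where d: "d < 10" "d \<notin> set ws" "d \<noteq> c"
  proof -
    have "card (insert c (set ws)) < card {..<10::nat}"
      using less.prems(2) set_ws c by (simp add: card_insert_if finite_dangling)
    then have "\<not> {..<10} \<subseteq> insert c (set ws)"
      by (metis List.finite_set finite_insert card_mono not_le)
    then show ?thesis using that by blast
  qed
  consider "inside s e = {}" | K where "K \<in> inside s e" "card ?D \<le> 7" | "card ?D = 8"
    using less.prems(2) by fastforce
  then show ?case
  proof cases
    case 1
    then show ?thesis by (simp add: extendable_def)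
  next
    case 2
    \<comment> \<open>This pillar lies in \<open>K\<close> and separates its endpoints, so each
      piece loses one of them and the measure drops on both sides.\<close>
    let ?q = "r K"
    let ?b = "set_pillar \<beta> s e ?q c"
    have K: "K \<in> V" "s \<le> l K" "l K < ?q" "?q < e"
      using 2 l_less_r by (auto simp: inside_def)
    have coh': "coherent ?b s ?q (c # ws)" "coherent ?b ?q e (ws @ [c])"
      using coherent_set_pillar[OF coh _ _ c, of ?q] K by auto
    have le8: "card X \<le> 8" if "X \<subseteq> insert c ?D" for X
    proof -
      have "card X \<le> card (insert c ?D)"
        using that finite_dangling by (intro card_mono) auto
      also have "\<dots> \<le> 8" using 2(2) by (simp add: card_insert_if finite_dangling)
      finally show ?thesis .
    qed
    have "?b ` dangling s ?q \<subseteq> insert c ?D" "?b ` dangling ?q e \<subseteq> insert c ?D"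
      using coh' set_ws by (auto simp: coherent_def)
    then have sub: "card (?b ` dangling s ?q) \<le> 8" "card (?b ` dangling ?q e) \<le> 8"
      using le8 by blast+
    have "card (?E \<inter> {s..<?q}) < card (?E \<inter> {s..<e})"
    proof (rule psubset_card_mono[OF finE])
      have "?q \<in> ?E \<inter> {s..<e}" "?q \<notin> ?E \<inter> {s..<?q}" using K by auto
      moreover have "?E \<inter> {s..<?q} \<subseteq> ?E \<inter> {s..<e}" using K by auto
      ultimately show "?E \<inter> {s..<?q} \<subset> ?E \<inter> {s..<e}" by (metis psubsetI)
    qed
    moreover have "card (?E \<inter> {?q..<e}) < card (?E \<inter> {s..<e})"
    proof (rule psubset_card_mono[OF finE])
      have "l K \<in> ?E \<inter> {s..<e}" "l K \<notin> ?E \<inter> {?q..<e}" using K by auto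
      moreover have "?E \<inter> {?q..<e} \<subseteq> ?E \<inter> {s..<e}" using K by auto
      ultimately show "?E \<inter> {?q..<e} \<subset> ?E \<inter> {s..<e}" by (metis psubsetI)
    qed
    ultimately have "extendable ?b s ?q" "extendable ?b ?q e"
      using less.hyps[OF _ coh'(1) sub(1)] less.hyps[OF _ coh'(2) sub(2)] K by simp_all
    then show ?thesis
      using extendable_set_pillar[OF assms(1) _ _ c(1), of s ?q e \<beta>] K c set_ws by auto
  next
    case 3
    obtain q1 q2 q3 where q: "s \<le> q1" "q1 \<le> q2" "q2 \<le> q3" "q3 \<le> e"
      and sp: "card (seen \<beta> s e s q1) \<le> 6" "card (seen \<beta> s e q1 q2) \<le> 6"
      "card (seen \<beta> s e q2 q3) \<le> 6" "card (seen \<beta> s e q3 e) \<le> 6"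
      using four_sparse_pieces[OF assms(1) coh] 3 len less.prems(3) by metis
    \<comment> \<open>The middle pillar is set first. The other two then stand in disjoint segments,
      and \<open>d\<close> is fresh in both.\<close>
    let ?b = "set_pillar \<beta> s e q2 c"
    let ?bl = "set_pillar ?b s q2 q1 d"
    let ?br = "set_pillar ?b q2 e q3 d"
    have coh': "coherent ?b s q2 (c # ws)" "coherent ?b q2 e (ws @ [c])"
      using coherent_set_pillar[OF coh _ _ c, of q2] q by auto
    have cohl: "coherent ?bl s q1 (d # c # ws)" "coherent ?bl q1 q2 ((c # ws) @ [d])"
      using coherent_set_pillar[OF coh'(1), of q1 d] q d by auto
    have cohr: "coherent ?br q2 q3 (d # ws @ [c])" "coherent ?br q3 e ((ws @ [c]) @ [d])"
      using coherent_set_pillar[OF coh'(2), of q3 d] q d by auto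
    \<comment> \<open>The condition on \<open>\<gamma>\<close> says that an interval dangling from
      the piece has block \<open>c\<close> or \<open>d\<close>, or is an old one with its old block;
      this gives 6 + 2 blocks.\<close>
    have piece: "extendable \<gamma> u v"
      if uv: "s \<le> u" "u \<le> v" "v \<le> e" and coh_uv: "coherent \<gamma> u v xs"
        and sp_uv: "card (seen \<beta> s e u v) \<le> 6"
        and \<gamma>: "\<And>I. \<gamma> I \<in> {c, d} \<or> \<gamma> I = \<beta> I \<and> I \<notin> inside s e \<or> I \<notin> dangling u v" for \<gamma> u v xs
    proof -
      have "\<gamma> ` dangling u v \<subseteq> {c, d} \<union> seen \<beta> s e u v"
      proof
        fix x assume "x \<in> \<gamma> ` dangling u v"
        then obtain I where I: "I \<in> dangling u v" "x = \<gamma> I" by blast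
        show "x \<in> {c, d} \<union> seen \<beta> s e u v"
        proof (cases "x \<in> {c, d}")
          case False
          then have "x = \<beta> I" "I \<notin> inside s e" using \<gamma>[of I] I by auto
          moreover have "I \<in> dangling s e \<and> u \<le> inner s I \<and> inner s I < v"
            using I(1) \<open>I \<notin> inside s e\<close> uv by (auto simp: dangling_def inside_def inner_def)
          ultimately show ?thesis unfolding seen_def by blast
        qed blast
      qed
      then have "card (\<gamma> ` dangling u v) \<le> card ({c, d} \<union> seen \<beta> s e u v)"
        using finite_seen by (intro card_mono) auto
      also have "\<dots> \<le> card {c, d} + card (seen \<beta> s e u v)" by (rule card_Un_le)
      also have "\<dots> \<le> 8" using sp_uv d by simp
      finally have "card (\<gamma> ` dangling u v) \<le> 8" .
      moreover have "card (?E \<inter> {u..<v}) < card (?E \<inter> {s..<e})"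
      proof (rule psubset_card_mono[OF finE])
        \<comment> \<open>A piece with all endpoints of the segment would see all 8 blocks, but it
          sees at most 6.\<close>
        have "?E \<inter> {u..<v} \<noteq> ?E \<inter> {s..<e}"
        proof
          assume eq: "?E \<inter> {u..<v} = ?E \<inter> {s..<e}"
          have "u \<le> inner s I \<and> inner s I < v" if "I \<in> dangling s e" for I
          proof -
            have "inner s I \<in> ?E \<inter> {s..<e}" using that by (auto simp: dangling_def inner_def)
            then show ?thesis using eq by auto
          qed
          then have "seen \<beta> s e u v = ?D" by (auto simp: seen_def)
          then show False using sp_uv 3 by simp
        qed
        then show "?E \<inter> {u..<v} \<subset> ?E \<inter> {s..<e}" using uv by auto
      qed
      ultimately show ?thesis using less.hyps coh_uv uv by blast
    qed
    have "extendable ?bl s q1" "extendable ?bl q1 q2"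
      by (rule piece[OF _ _ _ cohl(1) sp(1)] piece[OF _ _ _ cohl(2) sp(2)];
          use q in \<open>auto simp: set_pillar_def dangling_def inside_def\<close>)+
    then have "extendable ?b s q2"
      using extendable_set_pillar[OF assms(1) _ _ d(1), of s q1 q2 ?b] q d coh'(1)
      by (auto simp: coherent_def)
    moreover have "extendable ?br q2 q3" "extendable ?br q3 e"
      by (rule piece[OF _ _ _ cohr(1) sp(3)] piece[OF _ _ _ cohr(2) sp(4)];
          use q in \<open>auto simp: set_pillar_def dangling_def inside_def\<close>)+
    then have "extendable ?b q2 e"
      using extendable_set_pillar[OF assms(1) _ _ d(1), of q2 q3 e ?b] q d coh'(2)
      by (auto simp: coherent_def)
    ultimately show ?thesis
      using extendable_set_pillar[OF assms(1) _ _ c(1), of s q2 e \<beta>] q c set_ws by auto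
  qed
qed

theorem thirty_coloring:
  assumes "\<not> four_clique"
  obtains f :: "'a \<Rightarrow> nat" where "\<And>I. I \<in> V \<Longrightarrow> f I < 30"
    "\<And>I J. I \<in> V \<Longrightarrow> J \<in> V \<Longrightarrow> overlap I J \<Longrightarrow> f I \<noteq> f J"
proof -
  obtain e where e: "\<And>I. I \<in> V \<Longrightarrow> r I < e"
    using finite_V finite_nat_set_iff_bounded[of "r ` V"] by auto
  have dang: "dangling 0 e = {}" using e l_less_r by (fastforce simp: dangling_def)
  have ins: "inside 0 e = V" using e by (auto simp: inside_def)
  \<comment> \<open>Nothing dangles from the whole range, so the value of \<open>\<beta>\<close> is
    arbitrary and the list of blocks is empty.\<close>
  have "extendable (\<lambda>_. 0) 0 e"
    by (rule extendable_if_coherent[OF assms, of _ _ _ "[]"]) (simp_all add: coherent_def dang)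
  then obtain g :: "'a \<Rightarrow> nat \<times> nat" where g: "\<And>I. I \<in> V \<Longrightarrow> g I \<in> {..<10} \<times> {..<3}"
    "\<And>I J. I \<in> V \<Longrightarrow> J \<in> V \<Longrightarrow> overlap I J \<Longrightarrow> g I \<noteq> g J"
    unfolding extendable_def ins by blast
  \<comment> \<open>Ten blocks of three colors, numbered below 30.\<close>
  define f where "f I = 3 * fst (g I) + snd (g I)" for I
  have "f I < 30" if "I \<in> V" for I
    using g(1)[OF that] by (auto simp: f_def mem_Times_iff)
  moreover have "f I \<noteq> f J" if "I \<in> V" "J \<in> V" "overlap I J" for I J
    using g(1)[OF that(1)] g(1)[OF that(2)] g(2)[OF that]
    unfolding f_def mem_Times_iff prod_eq_iff lessThan_iff by presburger
  ultimately show ?thesis using that by blast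
qed

end

section \<open>Crossing chords and interleaved angles\<close>

text \<open>Twice the signed area of the triangle \<open>p q z\<close>.\<close>

definition turn :: "complex \<Rightarrow> complex \<Rightarrow> complex \<Rightarrow> real" where
  "turn p q z = Im (cnj (q - p) * (z - p))"

lemma turn_cyclic: "turn q z p = turn p q z"
  by (simp add: turn_def algebra_simps)

lemma turn_swap: "turn p z q = - turn p q z"
  by (simp add: turn_def algebra_simps)

lemma turn_degenerate [simp]: "turn p q p = 0" "turn p q q = 0"
  by (simp_all add: turn_def algebra_simps)

lemma turn_convex_combination:
  "turn p q ((1 - u) *\<^sub>R y + u *\<^sub>R z) = (1 - u) * turn p q y + u * turn p q z"
  by (simp add: turn_def algebra_simps)

definition circle_point :: "complex \<Rightarrow> real \<Rightarrow> real \<Rightarrow> complex" where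
  "circle_point c r t = c + of_real r * cis t"

text \<open>The product form shows the sign: for increasing angles in one period, every half
  difference lies between 0 and \<open>pi\<close>.\<close>

lemma turn_circle_point:
  "turn (circle_point c r a) (circle_point c r b) (circle_point c r t) =
     4 * r\<^sup>2 * sin ((b - a) / 2) * sin ((t - b) / 2) * sin ((t - a) / 2)"
proof -
  have "turn (circle_point c r a) (circle_point c r b) (circle_point c r t) =
      r\<^sup>2 * ((cos b - cos a) * (sin t - sin a) - (sin b - sin a) * (cos t - cos a))"
    by (simp add: turn_def circle_point_def algebra_simps power2_eq_square)
  also have "\<dots> = 4 * r\<^sup>2 * sin ((b - a) / 2) *
      (sin ((t + a) / 2) * cos ((b + a) / 2) - cos ((t + a) / 2) * sin ((b + a) / 2)) * sin ((t - a) / 2)"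
  proof -
    have "sin ((a - b) / 2) = - sin ((b - a) / 2)" "sin ((a - t) / 2) = - sin ((t - a) / 2)"
      by (metis minus_diff_eq minus_divide_left sin_minus)+
    then show ?thesis
      unfolding sin_diff_sin cos_diff_cos by (simp add: algebra_simps)
  qed
  also have "sin ((t + a) / 2) * cos ((b + a) / 2) - cos ((t + a) / 2) * sin ((b + a) / 2) = sin ((t - b) / 2)"
    unfolding sin_diff[symmetric] by (rule arg_cong[of _ _ sin]) (simp add: field_simps)
  finally show ?thesis .
qed

lemma turn_circle_point_pos:
  assumes "r > 0" "0 \<le> a" "a < b" "b < t" "t < 2 * pi"
  shows "turn (circle_point c r a) (circle_point c r b) (circle_point c r t) > 0"
  unfolding turn_circle_point using assms by (intro mult_pos_pos sin_gt_zero) auto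

text \<open>If the points coincided, their triangle with the point at the mean angle would be
  degenerate.\<close>

lemma circle_point_neq:
  assumes "r > 0" "0 \<le> a" "a < b" "b < 2 * pi"
  shows "circle_point c r a \<noteq> circle_point c r b"
  using turn_circle_point_pos[of r a "(a + b) / 2" b c] assms by auto

lemma open_segments_meet_if_interleaved:
  assumes "r > 0" "0 \<le> a" "a < x" "x < b" "b < y" "y < 2 * pi"
  shows "open_segment (circle_point c r a) (circle_point c r b) \<inter>
     open_segment (circle_point c r x) (circle_point c r y) \<noteq> {}"
proof -
  let ?P = "circle_point c r"
  \<comment> \<open>The four points satisfy an affine dependency whose coefficients are the areas of
    the triangles omitting one point each. Normalized, its two sides are the same point on both
    diagonals.\<close>
  define wa where "wa = turn (?P x) (?P b) (?P y)"
  define wb where "wb = turn (?P a) (?P x) (?P y)"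
  define wx where "wx = turn (?P a) (?P b) (?P y)"
  define wy where "wy = turn (?P a) (?P x) (?P b)"
  have pos: "wa > 0" "wb > 0" "wx > 0" "wy > 0"
    using assms by (auto simp: wa_def wb_def wx_def wy_def intro!: turn_circle_point_pos)
  have sum: "wa + wb = wx + wy"
    by (simp add: wa_def wb_def wx_def wy_def turn_def algebra_simps)
  have eq: "wa *\<^sub>R ?P a + wb *\<^sub>R ?P b = wx *\<^sub>R ?P x + wy *\<^sub>R ?P y"
    by (rule complex_eqI; simp add: wa_def wb_def wx_def wy_def turn_def algebra_simps)
  have seg: "(1 / (v + w)) *\<^sub>R (v *\<^sub>R p + w *\<^sub>R q) \<in> open_segment p q"
    if "v > 0" "w > 0" "p \<noteq> q" for v w and p q :: complex
    unfolding in_segment using that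
    by (intro conjI exI[of _ "w / (v + w)"]) (auto simp: field_simps scaleR_right_distrib)
  have "?P a \<noteq> ?P b" "?P x \<noteq> ?P y" using assms by (intro circle_point_neq; simp)+
  then show ?thesis
    using seg[of wa wb "?P a" "?P b"] seg[of wx wy "?P x" "?P y"] pos sum eq by auto
qed

lemma open_segments_meet_iff_interleaved:
  assumes "r > 0" "0 \<le> a" "a < b" "b < 2 * pi" "0 \<le> x" "x < y" "y < 2 * pi" "(a, b) \<noteq> (x, y)"
  shows "open_segment (circle_point c r a) (circle_point c r b) \<inter>
     open_segment (circle_point c r x) (circle_point c r y) \<noteq> {} \<longleftrightarrow>
     a < x \<and> x < b \<and> b < y \<or> x < a \<and> a < y \<and> y < b" (is "?meet \<longleftrightarrow> ?inter")
proof
  assume ?inter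
  then show ?meet
    using assms open_segments_meet_if_interleaved[of r a x b y c]
      open_segments_meet_if_interleaved[of r x a y b c] by (auto simp: Int_commute)
next
  let ?P = "circle_point c r"
  assume ?meet
  then obtain z where "z \<in> open_segment (?P a) (?P b)" "z \<in> open_segment (?P x) (?P y)"
    by blast
  then obtain u v where uv: "0 < u" "u < 1" "0 < v" "v < 1"
    and z: "z = (1 - u) *\<^sub>R ?P a + u *\<^sub>R ?P b" "z = (1 - v) *\<^sub>R ?P x + v *\<^sub>R ?P y"
    unfolding in_segment by blast
  \<comment> \<open>The side of the line through \<open>?P a\<close> and \<open>?P b\<close> on
    which a point lies. As the segments meet, \<open>?P x\<close> and \<open>?P y\<close> are
    strictly on opposite sides or both on the line; the latter would force equal pairs of
    angles.\<close>
  define g where "g t = turn (?P a) (?P b) (?P t)" for t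
  have g0: "(1 - v) * g x + v * g y = 0"
    using z turn_convex_combination[of "?P a" "?P b"] by (metis add_0 g_def mult_zero_right turn_degenerate)
  have neg: "g t < 0" if "a < t" "t < b" for t
    using turn_circle_point_pos[of r a t b c] turn_swap[of "?P a" "?P b" "?P t"] that assms
    by (simp add: g_def)
  have pos: "g t > 0" if "t < a \<or> b < t" "0 \<le> t" "t < 2 * pi" for t
    using turn_circle_point_pos[of r t a b c] turn_circle_point_pos[of r a b t c]
      turn_cyclic[of "?P a" "?P b" "?P t"] that assms by (auto simp: g_def)
  have zero: "g a = 0" "g b = 0" by (simp_all add: g_def)
  have same: False if "g x \<ge> 0" "g y \<ge> 0" "g x \<noteq> 0 \<or> g y \<noteq> 0"
    using that uv g0 by (smt (verit) mult_nonneg_nonneg mult_pos_pos)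
  have same': False if "g x \<le> 0" "g y \<le> 0" "g x \<noteq> 0 \<or> g y \<noteq> 0"
    using that uv g0 by (smt (verit) mult_nonneg_nonpos mult_pos_neg)
  have sgn: "g t < 0 \<longleftrightarrow> a < t \<and> t < b" "g t > 0 \<longleftrightarrow> t < a \<or> b < t" if "0 \<le> t" "t < 2 * pi" for t
    using neg[of t] pos[of t] zero that by (smt (verit))+
  show ?inter
    using same same' sgn[of x] sgn[of y] assms by (smt (verit))
qed

lemma chord_angles:
  assumes "chord c r X" "r > 0"
  obtains a b where "0 \<le> a" "a < b" "b < 2 * pi"
    "X = closed_segment (circle_point c r a) (circle_point c r b)"
proof -
  have ang: "\<exists>t. 0 \<le> t \<and> t < 2 * pi \<and> z = circle_point c r t" if "z \<in> sphere c r" for z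
  proof -
    let ?w = "(z - c) / of_real r"
    have "cmod ?w = 1" using that assms(2) by (simp add: norm_divide dist_norm norm_minus_commute)
    then have "(Re ?w)\<^sup>2 + (Im ?w)\<^sup>2 = 1" by (metis cmod_power2 one_power2)
    then obtain t where t: "0 \<le> t" "t < 2 * pi" "Re ?w = cos t" "Im ?w = sin t"
      using sincos_total_2pi by blast
    then have "?w = cis t" by (simp add: complex_eq_iff)
    then have "z = circle_point c r t" using assms(2) by (simp add: circle_point_def field_simps)
    then show ?thesis using t by blast
  qed
  obtain p q where pq: "p \<in> sphere c r" "q \<in> sphere c r" "p \<noteq> q" "X = closed_segment p q"
    using assms(1) by (auto simp: chord_def)
  obtain a b where ab: "0 \<le> a" "a < 2 * pi" "p = circle_point c r a"
    "0 \<le> b" "b < 2 * pi" "q = circle_point c r b"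
    using ang pq by metis
  show ?thesis
    using that[of a b] that[of b a] ab pq closed_segment_commute by (metis linorder_neqE_linordered_idom)
qed

section \<open>Pulling shared endpoints apart\<close>

text \<open>Shared endpoints are pulled apart without changing which intervals overlap: at a common
  point, intervals end before others start, longer intervals start earlier, and longer intervals end
  later.\<close>

lemma distinct_endpoints:
  fixes lo hi :: "'a \<Rightarrow> real"
  assumes "finite A" "\<And>X. X \<in> A \<Longrightarrow> lo X < hi X"
  shows "\<exists>l r :: 'a \<Rightarrow> nat. \<forall>X\<in>A. \<forall>Y\<in>A.
    (l X < l Y \<longleftrightarrow> lo X < lo Y \<or> lo X = lo Y \<and> hi Y < hi X) \<and>
    (r X < r Y \<longleftrightarrow> hi X < hi Y \<or> hi X = hi Y \<and> lo Y < lo X) \<and>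
    (l X < r Y \<longleftrightarrow> lo X < hi Y) \<and> (r X < l Y \<longleftrightarrow> hi X \<le> lo Y)"
proof -
  \<comment> \<open>The second component breaks ties: it is positive at starts and negative at ends,
    and the reciprocal length puts longer intervals first among starts and last among ends.\<close>
  define kl where "kl X = (lo X, 1 / (hi X - lo X))" for X
  define kr where "kr X = (hi X, - 1 / (hi X - lo X))" for X
  define lex :: "real \<times> real \<Rightarrow> real \<times> real \<Rightarrow> bool" where
    "lex p q \<longleftrightarrow> fst p < fst q \<or> fst p = fst q \<and> snd p < snd q" for p q
  define E where "E = kl ` A \<union> kr ` A"
  \<comment> \<open>Counting smaller keys embeds the finite set of keys into the naturals with its
    order.\<close>
  define rank where "rank p = card {q \<in> E. lex q p}" for p
  have fin: "finite {q \<in> E. lex q p}" for p using assms(1) by (simp add: E_def)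
  have less: "rank p < rank q" if "lex p q" "p \<in> E" for p q
    unfolding rank_def
    by (rule psubset_card_mono[OF fin]) (use that in \<open>auto simp: lex_def\<close>)
  have rank: "rank p < rank q \<longleftrightarrow> lex p q" if "p \<in> E" "q \<in> E" for p q
  proof -
    have "lex p q \<or> p = q \<or> lex q p" by (auto simp: lex_def prod_eq_iff)
    then show ?thesis using less[of p q] less[of q p] that by (auto simp: lex_def)
  qed
  have "kl X \<in> E" "kr X \<in> E" if "X \<in> A" for X using that by (auto simp: E_def)
  note rank = rank[OF this(1) this(1)] rank[OF this(2) this(2)] rank[OF this(1) this(2)] rank[OF this(2) this(1)]
  show ?thesis
  proof (rule exI[of _ "\<lambda>X. rank (kl X)"], rule exI[of _ "\<lambda>X. rank (kr X)"], intro ballI conjI)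
    fix X Y assume XY: "X \<in> A" "Y \<in> A"
    note XY' = assms(2)[OF XY(1)] assms(2)[OF XY(2)]
    have "0 < 1 / (hi X - lo X)" "0 < 1 / (hi Y - lo Y)" using XY' by auto
    then have pos: "- 1 / (hi X - lo X) < 1 / (hi Y - lo Y)" "\<not> 1 / (hi X - lo X) < - 1 / (hi Y - lo Y)"
      by linarith+
    have inv: "1 / (hi X - lo X) < 1 / (hi Y - lo Y) \<longleftrightarrow> hi Y - lo Y < hi X - lo X"
      "- 1 / (hi X - lo X) < - 1 / (hi Y - lo Y) \<longleftrightarrow> hi X - lo X < hi Y - lo Y"
      using XY' by (auto simp: field_simps)
    show "rank (kl X) < rank (kl Y) \<longleftrightarrow> lo X < lo Y \<or> lo X = lo Y \<and> hi Y < hi X"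
      using inv unfolding rank(1)[OF XY] by (auto simp: lex_def kl_def)
    show "rank (kr X) < rank (kr Y) \<longleftrightarrow> hi X < hi Y \<or> hi X = hi Y \<and> lo Y < lo X"
      using inv unfolding rank(2)[OF XY] by (auto simp: lex_def kr_def)
    show "rank (kl X) < rank (kr Y) \<longleftrightarrow> lo X < hi Y"
      using pos(2) rank(3)[OF XY] unfolding lex_def kr_def kl_def fst_conv snd_conv by blast
    show "rank (kr X) < rank (kl Y) \<longleftrightarrow> hi X \<le> lo Y"
      using pos(1) rank(4)[OF XY] unfolding lex_def kr_def kl_def fst_conv snd_conv by linarith
  qed
qed

section \<open>From circle graphs to interval systems\<close>

lemma complete_digraph_four_subgraph:
  assumes "finite A" "B \<subseteq> A" "card B = 4"
    "\<And>X Y. \<lbrakk>X \<in> B; Y \<in> B; X \<noteq> Y\<rbrakk> \<Longrightarrow> cross X Y"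
  shows "\<exists>H. subgraph H (with_proj (circle_graph A)) \<and> complete_digraph 4 H"
proof -
  interpret pair_graph "circle_graph A" using pair_graph_circle_graph[OF assms(1)] .
  define H :: "complex set pair_pre_digraph" where
    "H = \<lparr> pverts = B, parcs = {(X, Y). (X, Y) \<in> B \<times> B \<and> X \<noteq> Y} \<rparr>"
  have "complete_digraph 4 (with_proj H)"
    unfolding complete_digraph_pair_def using assms by (simp add: H_def finite_subset)
  moreover have "subgraph (with_proj H) (with_proj (circle_graph A))"
  proof (rule subgraphI)
    show "wf_digraph (with_proj H)" by unfold_locales (auto simp: H_def)
    show "wf_digraph (with_proj (circle_graph A))" by unfold_locales
  qed (use assms in \<open>auto simp: H_def circle_graph_def compatible_def\<close>)
  ultimately show ?thesis by blast
qed

theorem theorem1: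
  fixes c :: complex and r :: real and A :: "complex set set"
  assumes "r > 0"
    and "finite A"
    and "\<forall>X\<in>A. chord c r X"
    and "\<not> (\<exists>H. subgraph H (with_proj (circle_graph A)) \<and> complete_digraph 4 H)"
  shows "colorable (with_proj (circle_graph A)) 30
    \<and> chromatic_number (with_proj (circle_graph A)) \<le> 30"
proof -
  let ?P = "circle_point c r"
  have "\<forall>X\<in>A. \<exists>a b. 0 \<le> a \<and> a < b \<and> b < 2 * pi \<and> X = closed_segment (?P a) (?P b)"
    using chord_angles[OF _ assms(1)] assms(3) by metis
  then obtain lo hi where angles: "\<And>X. X \<in> A \<Longrightarrow> 0 \<le> lo X" "\<And>X. X \<in> A \<Longrightarrow> lo X < hi X"
    "\<And>X. X \<in> A \<Longrightarrow> hi X < 2 * pi" "\<And>X. X \<in> A \<Longrightarrow> X = closed_segment (?P (lo X)) (?P (hi X))"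
    by metis
  \<comment> \<open>The angles determine the chord, so distinct chords have distinct pairs of
    angles.\<close>
  have inj: "inj_on (\<lambda>X. (lo X, hi X)) A"
    using angles(4) by (intro inj_onI) (metis prod.inject)
  have interior: "rel_interior X = open_segment (?P (lo X)) (?P (hi X))" if "X \<in> A" for X
    using angles(4)[OF that] circle_point_neq[OF assms(1) angles(1-3)[OF that], of c]
      rel_interior_closed_segment[of "?P (lo X)" "?P (hi X)"] by metis
  have cross: "cross X Y \<longleftrightarrow> lo X < lo Y \<and> lo Y < hi X \<and> hi X < hi Y \<or>
      lo Y < lo X \<and> lo X < hi Y \<and> hi Y < hi X" if XY: "X \<in> A" "Y \<in> A" "X \<noteq> Y" for X Y
  proof -
    have "(lo X, hi X) \<noteq> (lo Y, hi Y)" using inj XY by (auto dest: inj_onD)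
    then show ?thesis
      unfolding cross_def interior[OF XY(1)] interior[OF XY(2)]
      by (intro open_segments_meet_iff_interleaved assms(1) angles XY)
  qed
  obtain l r' :: "complex set \<Rightarrow> nat" where "\<forall>X\<in>A. \<forall>Y\<in>A.
    (l X < l Y \<longleftrightarrow> lo X < lo Y \<or> lo X = lo Y \<and> hi Y < hi X) \<and>
    (r' X < r' Y \<longleftrightarrow> hi X < hi Y \<or> hi X = hi Y \<and> lo Y < lo X) \<and>
    (l X < r' Y \<longleftrightarrow> lo X < hi Y) \<and> (r' X < l Y \<longleftrightarrow> hi X \<le> lo Y)"
    by atomize_elim (intro distinct_endpoints assms(2) angles(2))
  then have lr: "l X < l Y \<longleftrightarrow> lo X < lo Y \<or> lo X = lo Y \<and> hi Y < hi X"
    "r' X < r' Y \<longleftrightarrow> hi X < hi Y \<or> hi X = hi Y \<and> lo Y < lo X"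
    "l X < r' Y \<longleftrightarrow> lo X < hi Y" "r' X < l Y \<longleftrightarrow> hi X \<le> lo Y"
    if "X \<in> A" "Y \<in> A" for X Y
    using that by blast+
  interpret interval_system A l r'
  proof
    show "inj_on l A"
    proof (rule inj_onI)
      fix X Y assume XY: "X \<in> A" "Y \<in> A" "l X = l Y"
      then have "lo X = lo Y" "hi X = hi Y" using lr(1)[of X Y] lr(1)[of Y X] by auto
      then show "X = Y" using inj XY by (auto dest: inj_onD)
    qed
    show "inj_on r' A"
    proof (rule inj_onI)
      fix X Y assume XY: "X \<in> A" "Y \<in> A" "r' X = r' Y"
      then have "lo X = lo Y" "hi X = hi Y" using lr(2)[of X Y] lr(2)[of Y X] by auto
      then show "X = Y" using inj XY by (auto dest: inj_onD)
    qed
    show "l X \<noteq> r' Y" if "X \<in> A" "Y \<in> A" for X Y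
      using lr(3)[OF that] lr(4)[OF that(2,1)] by auto
    show "l X < r' X" if "X \<in> A" for X
      using lr(3)[OF that that] angles(2)[OF that] by simp
  qed (rule assms(2))
  \<comment> \<open>For chords with a common endpoint the tie-breaking yields nested or disjoint
    intervals, in agreement with \<open>cross\<close>.\<close>
  have overlap: "overlap X Y \<longleftrightarrow> X \<noteq> Y \<and> cross X Y" if XY: "X \<in> A" "Y \<in> A" for X Y
    using cross[OF XY] unfolding overlap_def lr(1-3)[OF XY] lr(1-3)[OF XY(2,1)] by auto
  have "\<not> four_clique"
  proof
    assume four_clique
    then obtain I J K L where V: "I \<in> A" "J \<in> A" "K \<in> A" "L \<in> A"
      and "overlap I J" "overlap I K" "overlap I L" "overlap J K" "overlap J L" "overlap K L"
      unfolding four_clique_def by blast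
    note ov = this(5-) this(5-)[THEN overlap_sym[THEN iffD1]]
    \<comment> \<open>By \<open>overlap\<close>, overlapping intervals are distinct.\<close>
    have "card {I, J, K, L} = 4" using ov V overlap by auto
    moreover have "cross X Y" if "X \<in> {I, J, K, L}" "Y \<in> {I, J, K, L}" "X \<noteq> Y" for X Y
    proof -
      have "overlap X Y" using that ov by (elim insertE emptyE) simp_all
      moreover have "X \<in> A" "Y \<in> A" using that V by auto
      ultimately show ?thesis using overlap by blast
    qed
    ultimately show False
      using complete_digraph_four_subgraph[OF assms(2), of "{I, J, K, L}"] assms(4) V by blast
  qed
  then obtain f where f: "\<And>X. X \<in> A \<Longrightarrow> f X < (30 :: nat)"
    "\<And>X Y. X \<in> A \<Longrightarrow> Y \<in> A \<Longrightarrow> overlap X Y \<Longrightarrow> f X \<noteq> f Y"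
    using thirty_coloring by blast
  have "f X \<noteq> f Y" if "X \<in> A" "Y \<in> A" "X \<noteq> Y" "cross X Y" for X Y
    using f(2) overlap that by blast
  then have "proper_coloring (with_proj (circle_graph A)) f"
    by (auto simp: proper_coloring_def circle_graph_def arcs_ends_def arc_to_ends_def)
  moreover have "f ` verts (with_proj (circle_graph A)) \<subseteq> {..<30}"
    using f(1) by (auto simp: circle_graph_def)
  ultimately have "colorable (with_proj (circle_graph A)) 30"
    unfolding colorable_def by blast
  then show ?thesis
    unfolding chromatic_number_def by (simp add: Least_le)
qed

end
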